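(* The greatest common divisor of all Fermat-Wilson quotients $q_p(w_p)$, taken over all non-Wilson primes $p$, is $24$. In particular, $q_p(w_p)$ is never a prime number.
   Context: For a prime $p$, the Wilson quotient is the integer $w_p=\dfrac{(p-1)!+1}{p}$; $p$ is a Wilson prime if $p\mid w_p$, and a non-Wilson prime otherwise. For a prime $p$ and an integer $a$ not divisible by $p$, the Fermat quotient is the integer $q_p(a)=\dfrac{a^{p-1}-1}{p}$. For a non-Wilson prime $p$, the Fermat-Wilson quotient of $p$ is the integer $q_p(w_p)=\dfrac{w_p^{\,p-1}-1}{p}$ (for example $q_2(w_2)=q_3(w_3)=0$ since $w_2=w_3=1$). *)

theory Defs
  imports "HOL-Number_Theory.Number_Theory"
begin

definition wilson_quotient :: "nat \<Rightarrow> int" where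
  "wilson_quotient p = (fact (p - 1) + 1) div int p"

definition wilson_prime :: "nat \<Rightarrow> bool" where
  "wilson_prime p \<longleftrightarrow> prime p \<and> int p dvd wilson_quotient p"

definition non_wilson_prime :: "nat \<Rightarrow> bool" where
  "non_wilson_prime p \<longleftrightarrow> prime p \<and> \<not> wilson_prime p"

definition fermat_quotient :: "nat \<Rightarrow> int \<Rightarrow> int" where
  "fermat_quotient p a = (a ^ (p - 1) - 1) div int p"

definition fermat_wilson_quotient :: "nat \<Rightarrow> int" where
  "fermat_wilson_quotient p = fermat_quotient p (wilson_quotient p)"

text \<open>The integer divisions above are exact whenever the quotients are meaningful.\<close>

lemma wilson_quotient_exact:
  assumes "prime p"
  shows "int p * wilson_quotient p = fact (p - 1) + 1"
proof -
  have "[fact (p - 1) = - 1 :: int] (mod int p)"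
    using assms wilson_theorem by auto
  then have "int p dvd fact (p - 1) + 1"
    by (simp add: cong_iff_dvd_diff)
  then show ?thesis
    by (simp add: wilson_quotient_def)
qed

lemma fermat_quotient_exact:
  assumes "prime p" and "\<not> int p dvd a"
  shows "int p * fermat_quotient p a = a ^ (p - 1) - 1"
proof -
  have "coprime a (int p)"
    using assms by (metis coprime_commute prime_imp_coprime prime_nat_int_transfer)
  then have "[a ^ totient p = 1] (mod int p)"
    using residues.euler_theorem[of "int p" a] prime_gt_1_nat[OF assms(1)]
    by (simp add: residues_def)
  then have "int p dvd a ^ (p - 1) - 1"
    using assms(1) by (simp add: totient_prime cong_iff_dvd_diff)
  then show ?thesis
    by (simp add: fermat_quotient_def)
qed

end

theory Submission
  imports Defs
begin

text \<open>For a non-Wilson prime \<open>p > 3\<close> both 2 and 3 divide \<open>(p - 1)!\<close>, so the Wilson quotient \<open>w\<close>,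
  a divisor of \<open>(p - 1)! + 1\<close>, is coprime to 24. Hence \<open>w\<^sup>2 \<equiv> 1\<close> modulo 24, and since \<open>p - 1\<close> is even
  and \<open>p\<close> is coprime to 24, the quotient \<open>(w ^ (p - 1) - 1) / p\<close> is divisible by 24. Conversely, the
  Fermat-Wilson quotients of 7 and 11 already have greatest common divisor 24.\<close>

text \<open>The group of units modulo 24 has exponent 2: each of its eight residues squares to
  1.\<close>

lemma dvd_24_square_minus_1:
  fixes a :: int
  assumes "odd a" and "\<not> 3 dvd a"
  shows "24 dvd a ^ 2 - 1"
proof -
  have "a mod 24 \<in> {1, 5, 7, 11, 13, 17, 19, 23}"
    using assms by (simp; presburger)
  then have "[a ^ 2 = 1] (mod 24)"
    by (auto simp: cong_def power2_eq_square mod_mult_eq[of a 24 a, symmetric])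
  then show ?thesis
    by (simp add: cong_iff_dvd_diff)
qed

text \<open>Such an \<open>m\<close> is a factor of \<open>fact (p - 1)\<close>, so it would divide
  1. The cases needed are \<open>m = 2\<close> and \<open>m = 3\<close>.\<close>

lemma not_dvd_wilson_quotient:
  assumes "prime p" and "1 < m" and "m < p"
  shows "\<not> int m dvd wilson_quotient p"
proof
  assume "int m dvd wilson_quotient p"
  then have "int m dvd fact (p - 1) + 1"
    using wilson_quotient_exact[OF assms(1)] by (metis dvd_mult)
  moreover have "int m dvd fact (p - 1)"
    using assms by (metis One_nat_def Suc_pred dvd_fact less_Suc_eq_le less_or_eq_imp_le
        less_le_trans of_nat_dvd_iff of_nat_fact prime_gt_0_nat zero_less_one Suc_leI)
  ultimately have "int m dvd 1"
    by (simp add: dvd_add_right_iff)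
  then show False
    using assms(2) by simp
qed

lemma dvd_24_fermat_wilson_quotient:
  assumes "non_wilson_prime p"
  shows "24 dvd fermat_wilson_quotient p"
proof (cases "p \<le> 3")
  case True
  have "prime p"
    using assms by (simp add: non_wilson_prime_def)
  then have "p = 2 \<or> p = 3"
    using True prime_ge_2_nat[of p] by linarith
  \<comment> \<open>Here the Wilson quotient is 1, so the Fermat-Wilson quotient is 0.\<close>
  then show ?thesis
    by (auto simp: fermat_wilson_quotient_def fermat_quotient_def wilson_quotient_def fact_numeral)
next
  case False
  define w where "w = wilson_quotient p"
  have p: "prime p" and ndvd: "\<not> int p dvd w"
    using assms by (auto simp: non_wilson_prime_def wilson_prime_def w_def)
  have "odd p"
    using p False prime_odd_nat by simp
  then obtain k where k: "p - 1 = 2 * k"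
    by (elim oddE) simp
  have "24 dvd w ^ 2 - 1"
    using not_dvd_wilson_quotient[OF p, of 2] not_dvd_wilson_quotient[OF p, of 3] False
    by (intro dvd_24_square_minus_1) (auto simp: w_def)
  then have "[(w ^ 2) ^ k = 1 ^ k] (mod 24)"
    by (intro cong_pow) (simp add: cong_iff_dvd_diff)
  then have "24 dvd w ^ (p - 1) - 1"
    by (simp only: k power_mult power_one cong_iff_dvd_diff)
  then have dvd: "24 dvd int p * fermat_quotient p w"
    using fermat_quotient_exact[OF p ndvd] by simp
  have "\<not> p dvd 2" "\<not> p dvd 3"
    using False by (auto dest: dvd_imp_le)
  \<comment> \<open>Writing 24 in factored form lets primality of \<open>p\<close> reduce the claim
    to the factors 2 and 3.\<close>
  then have "\<not> p dvd 2 ^ 3 * 3"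
    using p by (metis prime_dvd_mult_iff prime_dvd_power)
  then have "coprime p 24"
    using p by (simp add: prime_imp_coprime)
  then have "coprime (24 :: int) (int p)"
    by (metis coprime_commute coprime_int_iff of_nat_numeral)
  then show ?thesis
    using dvd by (simp add: coprime_dvd_mult_right_iff fermat_wilson_quotient_def w_def)
qed

text \<open>The Wilson quotient of 7 is 103. Since 5 is a Wilson prime, 7 is the first prime with a
  nonzero value to contribute.\<close>

lemma fermat_wilson_quotient_7: "fermat_wilson_quotient 7 = 170578899504"
  by (simp add: fermat_wilson_quotient_def fermat_quotient_def wilson_quotient_def fact_numeral)

lemma fermat_wilson_quotient_11:
  "fermat_wilson_quotient 11 = 1387752405580695978098914368989316131852701063520729400"
  by (simp add: fermat_wilson_quotient_def fermat_quotient_def wilson_quotient_def fact_numeral)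

lemma non_wilson_prime_7: "non_wilson_prime 7"
  by (simp add: non_wilson_prime_def wilson_prime_def wilson_quotient_def fact_numeral)

lemma non_wilson_prime_11: "non_wilson_prime 11"
  by (simp add: non_wilson_prime_def wilson_prime_def wilson_quotient_def fact_numeral)

theorem theorem2:
  shows "Gcd {fermat_wilson_quotient p | p. non_wilson_prime p} = 24
    \<and> (\<forall>p. non_wilson_prime p \<longrightarrow> \<not> prime (fermat_wilson_quotient p))"
proof (intro conjI allI impI)
  let ?G = "Gcd {fermat_wilson_quotient p | p. non_wilson_prime p}"
  have "?G dvd fermat_wilson_quotient 7" "?G dvd fermat_wilson_quotient 11"
    using non_wilson_prime_7 non_wilson_prime_11 by (auto intro!: Gcd_dvd)
  then have "?G dvd gcd (fermat_wilson_quotient 7) (fermat_wilson_quotient 11)"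
    by (rule gcd_greatest)
  also have "\<dots> = 24"
    by (simp add: fermat_wilson_quotient_7 fermat_wilson_quotient_11 gcd_non_0_int)
  finally have "?G dvd 24" .
  moreover have "24 dvd ?G"
    by (rule Gcd_greatest) (auto intro: dvd_24_fermat_wilson_quotient)
  \<comment> \<open>Mutual divisibility fixes an integer only up to sign; \<open>Gcd\<close> is
    nonnegative.\<close>
  ultimately show "?G = 24"
    by (intro zdvd_antisym_nonneg) auto
next
  fix p
  assume "non_wilson_prime p"
  then have "24 dvd fermat_wilson_quotient p"
    by (rule dvd_24_fermat_wilson_quotient)
  \<comment> \<open>A prime multiple of 24 would equal both 2 and 3. The value 0 at
    \<open>p = 2\<close> and \<open>p = 3\<close> is covered too.\<close>
  moreover have "\<not> 24 dvd q" if "prime q" for q :: int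
  proof
    assume "24 dvd q"
    then have "2 dvd q" "3 dvd q"
      by presburger+
    then have "2 = q" "3 = q"
      using that by (simp_all add: primes_dvd_imp_eq)
    then show False
      by simp
  qed
  ultimately show "\<not> prime (fermat_wilson_quotient p)"
    by blast
qed

end
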